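(* Fix $\lambda>0$. For each integer $n>\lambda$ let $p_i=\frac{\lambda}{n}\left(1-\frac{\lambda}{n}\right)^{i-1}$ for $1\le i\le n$, let $T_1,\dots,T_n$ be independent random variables with $T_i\sim\mathrm{Exp}(p_i)$, and let $T=T^{(n)}=\max_{1\le i\le n}T_i$. Then, as $n\to\infty$, $$\frac{T-\frac{e^{\lambda}}{\lambda}\, n(\log n-\log\log n)}{n}\ \xrightarrow{\ \mathcal D\ }\ \mathrm{Gumbel}\left(-\frac{e^{\lambda}}{\lambda}\log\lambda,\ \frac{e^{\lambda}}{\lambda}\right),$$ where $\xrightarrow{\mathcal D}$ denotes convergence in distribution.
   Context: $\log$ is the natural logarithm. $\mathrm{Exp}(p)$ is the exponential distribution with rate $p$, i.e. $P(T_i>t)=e^{-p_i t}$ for $t\ge 0$. For $\mu\in\mathbb R$, $\beta>0$, $\mathrm{Gumbel}(\mu,\beta)$ is the probability law on $\mathbb R$ with distribution function $F(x)=\exp\left(-e^{-(x-\mu)/\beta}\right)$. ($T$ is the time to collect all $n$ coupon types in a continuous-time coupon collector's model in which type $i$ arrives at rate $p_i$.) *)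

theory Defs
  imports "HOL-Probability.Probability" "HOL-Real_Asymp.Real_Asymp"
begin

definition coupon_rate :: "real \<Rightarrow> nat \<Rightarrow> nat \<Rightarrow> real" where
  "coupon_rate lam n i = lam / real n * (1 - lam / real n) ^ (i - 1)"

definition gumbel_cdf :: "real \<Rightarrow> real \<Rightarrow> real \<Rightarrow> real" where
  "gumbel_cdf \<mu> \<beta> x = exp (- exp (- ((x - \<mu>) / \<beta>)))"

text \<open>Meaningful only for \<open>\<beta> > 0\<close>: otherwise \<open>gumbel_cdf \<mu> \<beta>\<close> is not a distribution function.\<close>

definition gumbel_distribution :: "real \<Rightarrow> real \<Rightarrow> real measure" where
  "gumbel_distribution \<mu> \<beta> = interval_measure (gumbel_cdf \<mu> \<beta>)"

lemma gumbel_cdf_mono: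
  assumes "\<beta> > 0" "x \<le> y"
  shows "gumbel_cdf \<mu> \<beta> x \<le> gumbel_cdf \<mu> \<beta> y"
  using assms by (simp add: gumbel_cdf_def divide_right_mono)

lemma isCont_gumbel_cdf:
  assumes "\<beta> > 0"
  shows "isCont (gumbel_cdf \<mu> \<beta>) x"
  unfolding gumbel_cdf_def using assms by (intro continuous_intros) auto

lemma gumbel_cdf_at_right:
  assumes "\<beta> > 0"
  shows "continuous (at_right x) (gumbel_cdf \<mu> \<beta>)"
  using isCont_gumbel_cdf[OF assms] by (rule continuous_at_imp_continuous_at_within)

lemma gumbel_cdf_at_top:
  assumes "\<beta> > 0"
  shows "(gumbel_cdf \<mu> \<beta> \<longlongrightarrow> 1) at_top"
  unfolding gumbel_cdf_def using assms by real_asymp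

lemma gumbel_cdf_at_bot:
  assumes "\<beta> > 0"
  shows "(gumbel_cdf \<mu> \<beta> \<longlongrightarrow> 0) at_bot"
  unfolding gumbel_cdf_def using assms by real_asymp

lemma real_distribution_gumbel:
  assumes "\<beta> > 0"
  shows "real_distribution (gumbel_distribution \<mu> \<beta>)"
  unfolding gumbel_distribution_def
  by (rule real_distribution_interval_measure
      [OF gumbel_cdf_mono[OF assms] gumbel_cdf_at_right[OF assms]
          gumbel_cdf_at_bot[OF assms] gumbel_cdf_at_top[OF assms]])

lemma cdf_gumbel_distribution:
  assumes "\<beta> > 0"
  shows "cdf (gumbel_distribution \<mu> \<beta>) = gumbel_cdf \<mu> \<beta>"
  unfolding gumbel_distribution_def
  by (rule cdf_interval_measure
      [OF gumbel_cdf_mono[OF assms] gumbel_cdf_at_right[OF assms] gumbel_cdf_at_bot[OF assms]])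

end

theory Submission
  imports Defs
begin

text \<open>
  By independence, the distribution function of the normalised maximum at \<open>x\<close> is
  \<open>\<Prod>i. 1 - a i\<close> with \<open>a i = exp (- t * p i)\<close>, where \<open>p i\<close> is the \<open>i\<close>-th rate and \<open>t\<close> the
  corresponding threshold. All \<open>a i\<close> tend to 0 uniformly, so the product behaves like
  \<open>exp (- (\<Sum>i. a i))\<close>. Counted from the smallest rate, the exponents are \<open>u * (1 + v) ^ j\<close> with
  \<open>v \<approx> lam / n\<close> and \<open>u \<approx> ln n - ln (ln n) + x * lam / exp lam\<close>. Only \<open>j\<close> of order
  \<open>n / ln n\<close> matter, and there \<open>(1 + v) ^ j \<approx> 1 + j * v\<close>: the sum is asymptotically geometric, namely
  \<open>exp (- u) / (u * v)\<close>, which tends to \<open>exp (- (x * lam / exp lam)) / lam\<close>.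
\<close>

section \<open>Products of \<open>1 - a i\<close> compared with the exponential of a sum\<close>

lemma prod_one_minus_le_exp:
  fixes a :: "'i \<Rightarrow> real"
  assumes "\<And>i. i \<in> A \<Longrightarrow> a i \<le> 1"
  shows "(\<Prod>i\<in>A. 1 - a i) \<le> exp (- (\<Sum>i\<in>A. a i))"
proof (cases "finite A")
  case True
  have "(\<Prod>i\<in>A. 1 - a i) \<le> (\<Prod>i\<in>A. exp (- a i))"
  proof (rule prod_mono)
    fix i assume "i \<in> A"
    then show "0 \<le> 1 - a i \<and> 1 - a i \<le> exp (- a i)"
      using assms exp_ge_add_one_self[of "- a i"] by simp
  qed
  also have "\<dots> = exp (- (\<Sum>i\<in>A. a i))"
    using True by (simp add: exp_sum sum_negf[symmetric])
  finally show ?thesis .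
qed simp

text \<open>Taking reciprocals turns this into \<open>1 + z \<le> exp z\<close> at
  \<open>z = a / (1 - a)\<close>. Weakening \<open>1 - a\<close> to \<open>1 - b\<close> makes the
  exponent linear in \<open>a\<close>, so that multiplying such bounds produces the plain sum of the
  \<open>a i\<close>.\<close>

lemma one_minus_ge_exp:
  fixes a :: real
  assumes "0 \<le> a" "a \<le> b" "b < 1"
  shows "exp (- (a / (1 - b))) \<le> 1 - a"
proof -
  have "1 / (1 - a) = 1 + a / (1 - a)"
    using assms by (simp add: field_simps)
  also have "\<dots> \<le> exp (a / (1 - a))"
    by (rule exp_ge_add_one_self)
  also have "\<dots> \<le> exp (a / (1 - b))"
    using assms by (simp add: frac_le)
  finally show ?thesis
    using assms by (simp add: exp_minus field_simps)
qed

lemma prod_one_minus_ge_exp: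
  fixes a :: "'i \<Rightarrow> real"
  assumes "\<And>i. i \<in> A \<Longrightarrow> 0 \<le> a i" "\<And>i. i \<in> A \<Longrightarrow> a i \<le> b" "b < 1"
  shows "exp (- ((\<Sum>i\<in>A. a i) / (1 - b))) \<le> (\<Prod>i\<in>A. 1 - a i)"
proof (cases "finite A")
  case True
  have "exp (- ((\<Sum>i\<in>A. a i) / (1 - b))) = (\<Prod>i\<in>A. exp (- (a i / (1 - b))))"
    using True by (simp add: exp_sum sum_negf[symmetric] sum_divide_distrib)
  also have "\<dots> \<le> (\<Prod>i\<in>A. 1 - a i)"
    using assms by (intro prod_mono conjI one_minus_ge_exp) auto
  finally show ?thesis .
qed simp

text \<open>The two exponential bounds differ only by the factor \<open>1 / (1 - b n)\<close> in the
  exponent, and the uniform bound \<open>b n\<close> drives it to 1.\<close>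

lemma tendsto_prod_one_minus:
  fixes a :: "'n \<Rightarrow> 'i \<Rightarrow> real"
  assumes bnd: "eventually (\<lambda>n. \<forall>i\<in>A n. 0 \<le> a n i \<and> a n i \<le> b n) F"
    and b: "(b \<longlongrightarrow> 0) F"
    and S: "((\<lambda>n. \<Sum>i\<in>A n. a n i) \<longlongrightarrow> s) F"
  shows "((\<lambda>n. \<Prod>i\<in>A n. 1 - a n i) \<longlongrightarrow> exp (- s)) F"
proof (rule tendsto_sandwich)
  have b1: "eventually (\<lambda>n. b n < 1) F"
    using order_tendstoD(2)[OF b, of 1] by simp
  show "eventually (\<lambda>n. exp (- ((\<Sum>i\<in>A n. a n i) / (1 - b n))) \<le> (\<Prod>i\<in>A n. 1 - a n i)) F"
    using bnd b1 by eventually_elim (rule prod_one_minus_ge_exp, auto)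
  show "eventually (\<lambda>n. (\<Prod>i\<in>A n. 1 - a n i) \<le> exp (- (\<Sum>i\<in>A n. a n i))) F"
    using bnd b1 by eventually_elim (rule prod_one_minus_le_exp, force)
  show "((\<lambda>n. exp (- (\<Sum>i\<in>A n. a n i))) \<longlongrightarrow> exp (- s)) F"
    by (intro tendsto_intros S)
  have "((\<lambda>n. exp (- ((\<Sum>i\<in>A n. a n i) / (1 - b n)))) \<longlongrightarrow> exp (- (s / (1 - 0)))) F"
    by (intro tendsto_intros S b) simp
  then show "((\<lambda>n. exp (- ((\<Sum>i\<in>A n. a n i) / (1 - b n)))) \<longlongrightarrow> exp (- s)) F"
    by simp
qed

section \<open>Sums of exponentials of a geometric sequence: bounds and limit\<close>

lemma sum_exp_affine:
  fixes u v :: real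
  assumes "u * v \<noteq> 0"
  shows "(\<Sum>j<m. exp (- (u * (1 + real j * v))))
    = exp (- u) / (1 - exp (- (u * v))) * (1 - exp (- (u * v * real m)))"
proof -
  have "exp (- (u * (1 + real j * v))) = exp (- u) * exp (- (u * v)) ^ j" for j
    by (simp add: exp_add[symmetric] exp_of_nat_mult[symmetric] algebra_simps)
  then have "(\<Sum>j<m. exp (- (u * (1 + real j * v)))) = exp (- u) * (\<Sum>j<m. exp (- (u * v)) ^ j)"
    by (simp add: sum_distrib_left)
  also have "\<dots> = exp (- u) * ((1 - exp (- (u * v)) ^ m) / (1 - exp (- (u * v))))"
    using assms by (simp add: sum_gp_strict)
  also have "exp (- (u * v)) ^ m = exp (- (u * v * real m))"
    by (simp add: exp_of_nat_mult[symmetric] algebra_simps)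
  finally show ?thesis by simp
qed

text \<open>Converse to Bernoulli's inequality on a bounded range: \<open>(1 + v) ^ j\<close> is at
  most \<open>exp (j * v)\<close>, hence at most \<open>1 / (1 - j * v)\<close>. The bound is affine
  in \<open>j\<close>, as \<open>sum_exp_affine\<close> requires.\<close>

lemma power_one_plus_le:
  fixes v d :: real
  assumes "0 < v" "real j * v \<le> d" "d < 1"
  shows "(1 + v) ^ j \<le> 1 + real j * (v / (1 - d))"
proof -
  have jv: "0 \<le> real j * v" using assms by simp
  have "(1 + v) ^ j \<le> exp v ^ j"
    using assms exp_ge_add_one_self[of v] by (intro power_mono) auto
  also have "\<dots> = exp (real j * v)"
    by (simp add: exp_of_nat_mult)
  also have "\<dots> \<le> 1 / (1 - real j * v)"
    using exp_ge_add_one_self[of "- (real j * v)"] assms by (simp add: exp_minus field_simps)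
  also have "\<dots> = 1 + real j * v / (1 - real j * v)"
    using assms by (simp add: field_simps)
  also have "\<dots> \<le> 1 + real j * v / (1 - d)"
    using assms jv by (intro add_left_mono frac_le) auto
  finally show ?thesis by simp
qed

lemma sum_exp_power_le:
  fixes u v :: real
  assumes "0 < u" "0 < v"
  shows "(\<Sum>j<n. exp (- (u * (1 + v) ^ j))) \<le> exp (- u) / (1 - exp (- (u * v)))"
proof -
  have "(\<Sum>j<n. exp (- (u * (1 + v) ^ j))) \<le> (\<Sum>j<n. exp (- (u * (1 + real j * v))))"
    using assms by (intro sum_mono) (simp add: Bernoulli_inequality)
  also have "\<dots> = exp (- u) / (1 - exp (- (u * v))) * (1 - exp (- (u * v * real n)))"
    using assms by (intro sum_exp_affine) simp
  also have "\<dots> \<le> exp (- u) / (1 - exp (- (u * v))) * 1"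
    using assms by (intro mult_left_mono) auto
  finally show ?thesis by simp
qed

text \<open>All terms are positive, so the sum may be cut off near \<open>w\<close>. Up to there
  \<open>power_one_plus_le\<close> with \<open>d = v * w\<close> bounds the exponents by affine ones
  with increment \<open>y\<close>, which leaves a geometric sum.\<close>

lemma sum_exp_power_ge:
  fixes u v w :: real
  assumes "0 < u" "0 < v" "0 \<le> w" "w + 1 \<le> real n" "v * w < 1"
  defines "y \<equiv> u * (v / (1 - v * w))"
  shows "exp (- u) / (1 - exp (- y)) * (1 - exp (- (y * w))) \<le> (\<Sum>j<n. exp (- (u * (1 + v) ^ j)))"
proof -
  \<comment> \<open>Rounding up gives \<open>w \<le> m\<close> while every \<open>j < m\<close>
    still satisfies \<open>j \<le> w\<close>; the spare 1 in \<open>w + 1 \<le> real n\<close>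
    absorbs the rounding in \<open>m \<le> n\<close>.\<close>
  define m where "m = nat \<lceil>w\<rceil>"
  have m: "w \<le> real m" "m \<le> n"
    using assms by (auto simp: m_def)
  have j: "real j \<le> w" if "j < m" for j
    using that unfolding m_def by linarith
  have y: "0 < y" using assms by (simp add: y_def)
  have "exp (- u) / (1 - exp (- y)) * (1 - exp (- (y * w)))
      \<le> exp (- u) / (1 - exp (- y)) * (1 - exp (- (y * real m)))"
    using y m by (intro mult_left_mono) (auto intro: mult_left_mono)
  also have "\<dots> = (\<Sum>j<m. exp (- (u * (1 + real j * (v / (1 - v * w))))))"
    using y unfolding y_def by (subst sum_exp_affine) auto
  also have "\<dots> \<le> (\<Sum>j<m. exp (- (u * (1 + v) ^ j)))"
  proof (rule sum_mono)
    fix j assume "j \<in> {..<m}"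
    then have "(1 + v) ^ j \<le> 1 + real j * (v / (1 - v * w))"
      using assms j by (intro power_one_plus_le) (auto simp: mult.commute)
    then show "exp (- (u * (1 + real j * (v / (1 - v * w))))) \<le> exp (- (u * (1 + v) ^ j))"
      using \<open>0 < u\<close> by simp
  qed
  also have "\<dots> \<le> (\<Sum>j<n. exp (- (u * (1 + v) ^ j)))"
    using m by (intro sum_mono2) auto
  finally show ?thesis .
qed

text \<open>Since \<open>1 - exp (- y)\<close> is asymptotic to \<open>y\<close>, the quotient
  behaves like \<open>exp (- u) / y\<close>; \<open>c\<close> is a common scale that makes numerator
  and denominator converge separately. A nonzero \<open>l\<close> keeps \<open>y\<close> away from 0
  eventually.\<close>

lemma tendsto_exp_div_one_minus_exp:
  fixes u y c :: "'n \<Rightarrow> real"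
  assumes u: "((\<lambda>n. exp (- u n) * c n) \<longlongrightarrow> k) F"
    and y: "(y \<longlongrightarrow> 0) F"
    and yc: "((\<lambda>n. y n * c n) \<longlongrightarrow> l) F" and "l \<noteq> 0"
  shows "((\<lambda>n. exp (- u n) / (1 - exp (- y n))) \<longlongrightarrow> k / l) F"
proof -
  have nz: "eventually (\<lambda>n. y n * c n \<noteq> 0) F"
    using tendsto_imp_eventually_ne[OF yc] \<open>l \<noteq> 0\<close> by blast
  have "((\<lambda>y::real. (1 - exp (- y)) / y) \<longlongrightarrow> 1) (at 0)"
    by real_asymp
  moreover have "filterlim y (at 0) F"
    using y nz by (auto simp: filterlim_at elim: eventually_mono)
  ultimately have e: "((\<lambda>n. (1 - exp (- y n)) / y n) \<longlongrightarrow> 1) F"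
    by (rule filterlim_compose)
  have "((\<lambda>n. exp (- u n) * c n / (y n * c n * ((1 - exp (- y n)) / y n))) \<longlongrightarrow> k / (l * 1)) F"
    using \<open>l \<noteq> 0\<close> by (intro tendsto_intros u yc e) auto
  moreover have "eventually (\<lambda>n. exp (- u n) * c n / (y n * c n * ((1 - exp (- y n)) / y n))
      = exp (- u n) / (1 - exp (- y n))) F"
    using nz by eventually_elim (auto simp: field_simps)
  ultimately show ?thesis
    by (simp add: tendsto_cong)
qed

text \<open>For \<open>n > l\<close>, the factor \<open>exp (l + ...)\<close> is exactly
  \<open>exp l * (1 - l / n) ^ (n - 1)\<close>, so \<open>u n\<close> is the threshold times the
  smallest rate, with no approximation made. The first claim later makes the individual terms
  uniformly small.\<close>

lemma tendsto_sum_exp_power: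
  fixes l x :: real
  assumes "l > 0"
  defines "u \<equiv> (\<lambda>n::nat. (ln (real n) - ln (ln (real n)) + x) * exp (l + (real n - 1) * ln (1 - l / real n)))"
    and "v \<equiv> (\<lambda>n::nat. l / (real n - l))"
  shows "filterlim u at_top sequentially"
    and "(\<lambda>n. \<Sum>j<n. exp (- (u n * (1 + v n) ^ j))) \<longlonglongrightarrow> exp (- x) / l"
proof -
  define s where "s n = ln (real n) - ln (ln (real n)) + x" for n :: nat
  define G where "G n = exp (l + (real n - 1) * ln (1 - l / real n))" for n :: nat
  \<comment> \<open>The order of the number of terms that matter: the increment
    \<open>u n * v n\<close> is asymptotic to \<open>l * ln n / n\<close>.\<close>
  define c where "c n = real n / ln (real n)" for n :: nat
  \<comment> \<open>The truncation point for the lower bound: any \<open>w\<close> with \<open>n / ln n \<ll> w \<ll> n\<close> would do.\<close>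
  define w where "w n = real n / sqrt (ln (real n))" for n :: nat
  define K where "K n = 1 / (1 - v n * w n)" for n :: nat
  have u_eq: "u n = s n * G n" for n
    by (simp add: u_def s_def G_def)
  have exp_u: "exp (- u n) = exp (- s n) * exp (- (s n * (G n - 1)))" for n
    by (simp add: u_eq algebra_simps flip: exp_add)
  have G: "G \<longlonglongrightarrow> 1"
    unfolding G_def using \<open>l > 0\<close> by real_asymp
  \<comment> \<open>\<open>G n\<close> tending to 1 does not suffice inside
    \<open>exp (- u n)\<close>, because \<open>s n\<close> is unbounded; here \<open>G n - 1\<close>
    is of order \<open>1 / n\<close> against \<open>s n\<close> of order
    \<open>ln n\<close>.\<close>
  have sG: "(\<lambda>n. s n * (G n - 1)) \<longlonglongrightarrow> 0"
    unfolding G_def s_def using \<open>l > 0\<close> by real_asymp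
  have "(\<lambda>n. exp (- s n) * c n) \<longlonglongrightarrow> exp (- x)"
    unfolding s_def c_def by real_asymp
  then have "(\<lambda>n. exp (- s n) * c n * exp (- (s n * (G n - 1)))) \<longlonglongrightarrow> exp (- x) * exp (- 0)"
    by (intro tendsto_intros sG)
  then have uc: "(\<lambda>n. exp (- u n) * c n) \<longlonglongrightarrow> exp (- x)"
    by (simp add: exp_u mult_ac)
  have "filterlim s at_top sequentially"
    unfolding s_def by real_asymp
  then show u: "filterlim u at_top sequentially"
    unfolding u_eq[abs_def] by (rule filterlim_at_top_mult_tendsto_pos[OF G, rotated]) simp
  have "(\<lambda>n. s n / ln (real n)) \<longlonglongrightarrow> 1" "(\<lambda>n. v n * real n) \<longlonglongrightarrow> l"
    unfolding s_def v_def using \<open>l > 0\<close> by real_asymp+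
  then have "(\<lambda>n. s n / ln (real n) * G n * (v n * real n)) \<longlonglongrightarrow> 1 * 1 * l"
    by (intro tendsto_intros G)
  then have yc: "(\<lambda>n. u n * v n * c n) \<longlonglongrightarrow> l"
    by (simp add: u_eq c_def field_simps)
  have c: "(\<lambda>n. 1 / c n) \<longlonglongrightarrow> 0"
    unfolding c_def by real_asymp
  have c0: "eventually (\<lambda>n. c n \<noteq> 0) sequentially"
    using eventually_gt_at_top[of 1] by eventually_elim (simp add: c_def)
  have small: "y \<longlonglongrightarrow> 0" if "(\<lambda>n. y n * c n) \<longlonglongrightarrow> l" for y
  proof -
    have "(\<lambda>n. y n * c n * (1 / c n)) \<longlonglongrightarrow> l * 0"
      by (intro tendsto_intros that c)
    moreover have "eventually (\<lambda>n. y n * c n * (1 / c n) = y n) sequentially"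
      using c0 by eventually_elim simp
    ultimately show ?thesis
      by (simp add: tendsto_cong)
  qed
  have upper: "(\<lambda>n. exp (- u n) / (1 - exp (- (u n * v n)))) \<longlonglongrightarrow> exp (- x) / l"
    using \<open>l > 0\<close> by (intro tendsto_exp_div_one_minus_exp[OF uc small[OF yc] yc]) simp
  have K: "K \<longlonglongrightarrow> 1"
    unfolding K_def v_def w_def using \<open>l > 0\<close> by real_asymp
  define y where "y n = u n * (v n / (1 - v n * w n))" for n
  have "(\<lambda>n. u n * v n * c n * K n) \<longlonglongrightarrow> l * 1"
    by (intro tendsto_intros yc K)
  then have yKc: "(\<lambda>n. y n * c n) \<longlonglongrightarrow> l"
    by (simp add: K_def y_def field_simps)
  have "(\<lambda>n. exp (- u n) / (1 - exp (- y n))) \<longlonglongrightarrow> exp (- x) / l"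
    using \<open>l > 0\<close> by (intro tendsto_exp_div_one_minus_exp[OF uc small[OF yKc] yKc]) simp
  moreover have "(\<lambda>n. exp (- (y n * w n))) \<longlonglongrightarrow> 0"
  proof -
    \<comment> \<open>\<open>w n\<close> is \<open>c n * sqrt (ln n)\<close>, so it exceeds the
      relevant scale by an unbounded factor and the truncation costs nothing in the limit.\<close>
    have "filterlim (\<lambda>n. y n * c n * sqrt (ln (real n))) at_top sequentially"
      using \<open>l > 0\<close> by (rule filterlim_tendsto_pos_mult_at_top[OF yKc]) real_asymp
    moreover have "eventually (\<lambda>n. y n * c n * sqrt (ln (real n)) = y n * w n) sequentially"
      using eventually_gt_at_top[of 1]
      by eventually_elim (simp add: c_def w_def field_simps)
    ultimately have "filterlim (\<lambda>n. y n * w n) at_top sequentially"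
      by (simp add: filterlim_cong)
    then show ?thesis
      by (intro filterlim_compose[OF exp_at_bot]) (simp add: filterlim_uminus_at_top)
  qed
  ultimately have "(\<lambda>n. exp (- u n) / (1 - exp (- y n)) * (1 - exp (- (y n * w n)))) \<longlonglongrightarrow> exp (- x) / l * (1 - 0)"
    by (rule tendsto_mult[OF _ tendsto_diff[OF tendsto_const]])
  then have lower: "(\<lambda>n. exp (- u n) / (1 - exp (- y n)) * (1 - exp (- (y n * w n)))) \<longlonglongrightarrow> exp (- x) / l"
    by simp
  have pos: "eventually (\<lambda>n. 0 < u n) sequentially" "eventually (\<lambda>n. 0 < v n) sequentially"
    using u \<open>l > 0\<close> unfolding v_def by (auto simp: filterlim_at_top_dense) real_asymp
  have w: "eventually (\<lambda>n. 0 \<le> w n) sequentially" "eventually (\<lambda>n. w n + 1 \<le> real n) sequentially"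
    "eventually (\<lambda>n. v n * w n < 1) sequentially"
    unfolding v_def w_def using \<open>l > 0\<close> by real_asymp+
  show "(\<lambda>n. \<Sum>j<n. exp (- (u n * (1 + v n) ^ j))) \<longlonglongrightarrow> exp (- x) / l"
  proof (rule tendsto_sandwich[OF _ _ lower upper])
    show "eventually (\<lambda>n. exp (- u n) / (1 - exp (- y n)) * (1 - exp (- (y n * w n)))
        \<le> (\<Sum>j<n. exp (- (u n * (1 + v n) ^ j)))) sequentially"
      using pos w unfolding y_def by eventually_elim (rule sum_exp_power_ge)
    show "eventually (\<lambda>n. (\<Sum>j<n. exp (- (u n * (1 + v n) ^ j)))
        \<le> exp (- u n) / (1 - exp (- (u n * v n)))) sequentially"
      using pos by eventually_elim (rule sum_exp_power_le)
  qed
qed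

section \<open>Maxima of independent exponentials and the coupon rates\<close>

lemma (in prob_space) prob_Max_exponential_le:
  assumes indep: "indep_vars (\<lambda>_. borel) X I" and I: "finite I" "I \<noteq> {}"
    and distr: "\<And>i. i \<in> I \<Longrightarrow> distributed M lborel (X i) (exponential_density (p i))"
    and p: "\<And>i. i \<in> I \<Longrightarrow> 0 < p i" and t: "0 \<le> t"
  shows "\<P>(\<omega> in M. Max ((\<lambda>i. X i \<omega>) ` I) \<le> t) = (\<Prod>i\<in>I. 1 - exp (- t * p i))"
proof -
  have "{\<omega> \<in> space M. Max ((\<lambda>i. X i \<omega>) ` I) \<le> t} = (\<Inter>i\<in>I. X i -` {..t} \<inter> space M)"
    using I by auto
  then have "\<P>(\<omega> in M. Max ((\<lambda>i. X i \<omega>) ` I) \<le> t) = (\<Prod>i\<in>I. prob (X i -` {..t} \<inter> space M))"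
    using indep_varsD[OF indep I(2,1), of "\<lambda>_. {..t}"] by simp
  also have "\<dots> = (\<Prod>i\<in>I. 1 - exp (- t * p i))"
  proof (rule prod.cong)
    fix i assume i: "i \<in> I"
    have "X i -` {..t} \<inter> space M = {\<omega> \<in> space M. X i \<omega> \<le> t}" by auto
    then show "prob (X i -` {..t} \<inter> space M) = 1 - exp (- t * p i)"
      using exponential_distributedD_le[OF distr[OF i] t p[OF i]] by simp
  qed simp
  finally show ?thesis .
qed

lemma coupon_rate_pos:
  assumes "0 < lam" "lam < real n"
  shows "0 < coupon_rate lam n i"
  using assms by (simp add: coupon_rate_def)

text \<open>Counting from the smallest rate turns the decreasing ratio
  \<open>q = 1 - lam / n\<close> into the growing ratio \<open>1 / q = 1 + lam / (n - lam)\<close>,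
  the form that \<open>tendsto_sum_exp_power\<close> handles.\<close>

lemma coupon_rate_rev:
  assumes "0 < lam" "lam < real n" "j < n"
  shows "coupon_rate lam n (n - j)
    = lam / real n * exp ((real n - 1) * ln (1 - lam / real n)) * (1 + lam / (real n - lam)) ^ j"
proof -
  define q where "q = 1 - lam / real n"
  have q: "q > 0" using assms by (simp add: q_def)
  have "exp ((real n - 1) * ln q) = q ^ (n - 1)"
    using exp_of_nat_mult[of "n - 1" "ln q"] q assms by (simp add: of_nat_diff)
  also have "\<dots> = q ^ (n - j - 1) * q ^ j"
    using assms by (simp flip: power_add)
  finally have "exp ((real n - 1) * ln q) * (1 / q) ^ j = q ^ (n - j - 1)"
    using q by (simp add: power_divide)
  moreover have "1 + lam / (real n - lam) = 1 / q"
    using assms by (simp add: q_def field_simps)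
  ultimately show ?thesis
    by (simp add: coupon_rate_def flip: q_def)
qed

lemma tendsto_prod_coupon:
  fixes lam x :: real
  assumes "lam > 0"
  defines "t \<equiv> (\<lambda>n::nat. exp lam / lam * real n * (ln (real n) - ln (ln (real n))) + real n * x)"
  shows "(\<lambda>n. \<Prod>i\<in>{1..n}. 1 - exp (- t n * coupon_rate lam n i))
    \<longlonglongrightarrow> gumbel_cdf (- (exp lam / lam * ln lam)) (exp lam / lam) x"
proof -
  \<comment> \<open>Chosen so that
    \<open>t n * lam / n = exp lam * (ln n - ln (ln n) + z)\<close>.\<close>
  define z where "z = x * lam / exp lam"
  define u where "u n = (ln (real n) - ln (ln (real n)) + z) * exp (lam + (real n - 1) * ln (1 - lam / real n))"
    for n :: nat
  define v where "v n = lam / (real n - lam)" for n :: nat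
  define a where "a n j = exp (- (u n * (1 + v n) ^ j))" for n j
  have u: "filterlim u at_top sequentially" and S: "(\<lambda>n. \<Sum>j<n. a n j) \<longlonglongrightarrow> exp (- z) / lam"
    using tendsto_sum_exp_power[OF \<open>lam > 0\<close>, of z] by (simp_all add: u_def[abs_def] v_def a_def)
  have "(\<lambda>n. \<Prod>j\<in>{..<n}. 1 - a n j) \<longlonglongrightarrow> exp (- (exp (- z) / lam))"
  proof (rule tendsto_prod_one_minus[OF _ _ S])
    show "(\<lambda>n. exp (- u n)) \<longlonglongrightarrow> 0"
      using u by (intro filterlim_compose[OF exp_at_bot]) (simp add: filterlim_uminus_at_top)
    have "eventually (\<lambda>n. 0 < u n) sequentially" "eventually (\<lambda>n. 0 < v n) sequentially"
      using u \<open>lam > 0\<close> unfolding v_def by (auto simp: filterlim_at_top_dense) real_asymp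
    then show "eventually (\<lambda>n. \<forall>j\<in>{..<n}. 0 \<le> a n j \<and> a n j \<le> exp (- u n)) sequentially"
      by eventually_elim (auto simp: a_def)
  qed
  also have "exp (- (exp (- z) / lam)) = gumbel_cdf (- (exp lam / lam * ln lam)) (exp lam / lam) x"
  proof -
    \<comment> \<open>The location parameter absorbs the factor \<open>1 / lam\<close>, as
      \<open>exp (- z) / lam = exp (- (z + ln lam))\<close>.\<close>
    have "(x - - (exp lam / lam * ln lam)) / (exp lam / lam) = z + ln lam"
      using \<open>lam > 0\<close> by (simp add: z_def field_simps)
    then show ?thesis
      using \<open>lam > 0\<close> by (simp add: gumbel_cdf_def exp_diff exp_minus)
  qed
  finally have lim: "(\<lambda>n. \<Prod>j<n. 1 - a n j) \<longlonglongrightarrow> gumbel_cdf (- (exp lam / lam * ln lam)) (exp lam / lam) x" .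
  have "eventually (\<lambda>n. lam < real n) sequentially"
    by real_asymp
  then have "eventually (\<lambda>n. (\<Prod>j<n. 1 - a n j) = (\<Prod>i\<in>{1..n}. 1 - exp (- t n * coupon_rate lam n i))) sequentially"
  proof eventually_elim
    case (elim n)
    have "t n * coupon_rate lam n (n - j) = u n * (1 + v n) ^ j" if "j < n" for j
    proof -
      have "t n * (lam / real n) = exp lam * (ln (real n) - ln (ln (real n)) + z)"
        using \<open>lam > 0\<close> elim by (simp add: t_def z_def field_simps)
      then have "t n * (lam / real n) * (exp ((real n - 1) * ln (1 - lam / real n)) * (1 + v n) ^ j)
          = u n * (1 + v n) ^ j"
        by (simp only: u_def exp_add mult_ac)
      then show ?thesis
        unfolding coupon_rate_rev[OF \<open>lam > 0\<close> elim that] v_def by (simp only: mult_ac)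
    qed
    then have "(\<Prod>j<n. 1 - a n j) = (\<Prod>j<n. 1 - exp (- t n * coupon_rate lam n (n - j)))"
      by (intro prod.cong) (auto simp: a_def)
    also have "\<dots> = (\<Prod>i\<in>{1..n}. 1 - exp (- t n * coupon_rate lam n i))"
      by (rule prod.reindex_bij_witness[of _ "\<lambda>i. n - i" "\<lambda>j. n - j"]) auto
    finally show ?case .
  qed
  then show ?thesis
    using lim by (simp add: tendsto_cong)
qed

theorem theorem1:
  fixes lam :: real
    and M :: "nat \<Rightarrow> 'a measure"
    and X :: "nat \<Rightarrow> nat \<Rightarrow> 'a \<Rightarrow> real"
    and T :: "nat \<Rightarrow> 'a \<Rightarrow> real"
  assumes "lam > 0"
    and "\<And>n. real n > lam \<Longrightarrow> prob_space (M n)"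
    and "\<And>n. real n > lam \<Longrightarrow> prob_space.indep_vars (M n) (\<lambda>_. borel) (X n) {1..n}"
    and "\<And>n i. real n > lam \<Longrightarrow> i \<in> {1..n} \<Longrightarrow>
           distributed (M n) lborel (X n i) (exponential_density (coupon_rate lam n i))"
    and "\<And>n \<omega>. real n > lam \<Longrightarrow> \<omega> \<in> space (M n) \<Longrightarrow> T n \<omega> = Max ((\<lambda>i. X n i \<omega>) ` {1..n})"
  shows "weak_conv_m
           (\<lambda>n. distr (M n) borel
              (\<lambda>\<omega>. (T n \<omega> - exp lam / lam * real n * (ln (real n) - ln (ln (real n)))) / real n))
           (gumbel_distribution (- (exp lam / lam * ln lam)) (exp lam / lam))"
  unfolding weak_conv_m_def weak_conv_def
proof (intro allI impI)
  fix x :: real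
  define \<mu> where "\<mu> = - (exp lam / lam * ln lam)"
  define \<beta> where "\<beta> = exp lam / lam"
  define t where "t n = \<beta> * real n * (ln (real n) - ln (ln (real n))) + real n * x" for n :: nat
  have \<beta>: "\<beta> > 0" using \<open>lam > 0\<close> by (simp add: \<beta>_def)
  let ?Z = "\<lambda>n \<omega>. (T n \<omega> - \<beta> * real n * (ln (real n) - ln (ln (real n)))) / real n"
  \<comment> \<open>The exponential distribution function is applied at \<open>t n\<close>, which
    must be nonnegative; for negative \<open>x\<close> this holds only eventually.\<close>
  have "filterlim t at_top sequentially"
    unfolding t_def using \<beta> by real_asymp
  then have "eventually (\<lambda>n. 0 < t n) sequentially"
    by (simp add: filterlim_at_top_dense)
  moreover have "eventually (\<lambda>n. lam < real n) sequentially"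
    by real_asymp
  ultimately have "eventually (\<lambda>n. (\<Prod>i\<in>{1..n}. 1 - exp (- t n * coupon_rate lam n i))
      = cdf (distr (M n) borel (?Z n)) x) sequentially"
  proof eventually_elim
    case (elim n)
    interpret prob_space "M n" using assms(2) elim by blast
    \<comment> \<open>Positivity of \<open>n\<close> makes the index set of the maximum nonempty and
      allows multiplying the inequality \<open>?Z n \<omega> \<le> x\<close> through by
      \<open>n\<close>.\<close>
    have n: "0 < n" using elim \<open>lam > 0\<close> by (cases n) auto
    have [measurable]: "X n i \<in> borel_measurable (M n)" if "i \<in> {1..n}" for i
      using distributed_measurable[OF assms(4)[OF elim(2) that]] by simp
    have "(\<lambda>\<omega>. Max ((\<lambda>i. X n i \<omega>) ` {1..n})) \<in> borel_measurable (M n)"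
      by (rule borel_measurable_Max) auto
    then have [measurable]: "T n \<in> borel_measurable (M n)"
      using assms(5)[OF elim(2)] by (subst measurable_cong)
    have "cdf (distr (M n) borel (?Z n)) x = prob (?Z n -` {..x} \<inter> space (M n))"
      unfolding cdf_def by (rule measure_distr) measurable
    also have "?Z n -` {..x} \<inter> space (M n) = {\<omega> \<in> space (M n). Max ((\<lambda>i. X n i \<omega>) ` {1..n}) \<le> t n}"
      using n assms(5)[OF elim(2)] by (auto simp: t_def pos_divide_le_eq algebra_simps)
    also have "prob \<dots> = (\<Prod>i\<in>{1..n}. 1 - exp (- t n * coupon_rate lam n i))"
      using elim n assms(3,4) \<open>lam > 0\<close> by (intro prob_Max_exponential_le) (auto intro: coupon_rate_pos)
    finally show ?case ..
  qed
  moreover have "(\<lambda>n. \<Prod>i\<in>{1..n}. 1 - exp (- t n * coupon_rate lam n i)) \<longlonglongrightarrow> gumbel_cdf \<mu> \<beta> x"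
    using tendsto_prod_coupon[OF \<open>lam > 0\<close>, of x] unfolding t_def \<mu>_def \<beta>_def .
  ultimately have "(\<lambda>n. cdf (distr (M n) borel (?Z n)) x) \<longlonglongrightarrow> cdf (gumbel_distribution \<mu> \<beta>) x"
    unfolding cdf_gumbel_distribution[OF \<beta>] by (simp add: tendsto_cong)
  then show "(\<lambda>n. cdf (distr (M n) borel
        (\<lambda>\<omega>. (T n \<omega> - exp lam / lam * real n * (ln (real n) - ln (ln (real n)))) / real n)) x)
      \<longlonglongrightarrow> cdf (gumbel_distribution (- (exp lam / lam * ln lam)) (exp lam / lam)) x"
    unfolding \<mu>_def \<beta>_def .
qed

end
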